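(* Let the sequence $(b_0,b_1,\ldots)$ be defined by $b_0:=0$ and $b_k:=E_{2k-1}(1)/(2k-1)!$ for $k\ge1$, where $E_j(x)$ are the Euler polynomials. Then for all $n\ge1$, $$H_n(b_k)=(-1)^n\frac{(4n+2)!}{(2n-1)!}\cdot H_n\left(\frac{E_{2k+1}(1)}{(2k+1)!}\right).$$
   Context: For a sequence $(a_k)_{k\ge 0}$ and $n\ge 0$, $H_n(a_k):=\det(a_{i+j})_{0\le i,j\le n}$ denotes the $(n+1)\times(n+1)$ Hankel determinant; all sequences are indexed by $k\ge0$. The Euler polynomials are defined by $\frac{2e^{xt}}{e^t+1}=\sum_{n\ge0}E_n(x)\frac{t^n}{n!}$. *)

theory Defs
  imports
    "Jordan_Normal_Form.Determinant"
    "HOL-Computational_Algebra.Formal_Power_Series"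
begin

text \<open>The value \<open>E\<^sub>n(x)\<close>, read off from \<open>2 e\<^bsup>xt\<^esup> / (e\<^bsup>t\<^esup> + 1) = (\<Sum>n. E\<^sub>n(x) t\<^bsup>n\<^esup> / n!)\<close>
  as an identity of formal power series in \<open>t\<close>.\<close>

definition euler_poly :: "nat \<Rightarrow> real \<Rightarrow> real" where
  "euler_poly n x = fact n * fps_nth (fps_const 2 * fps_exp x / (fps_exp 1 + 1)) n"

lemma euler_poly_generating_function:
  "Abs_fps (\<lambda>n. euler_poly n x / fact n) = fps_const 2 * fps_exp x / (fps_exp 1 + 1)"
  by (simp add: fps_eq_iff euler_poly_def)

lemma euler_poly_generating_function_mult:
  "Abs_fps (\<lambda>n. euler_poly n x / fact n) * (fps_exp 1 + 1) = fps_const 2 * fps_exp x"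
proof -
  have "fps_nth (fps_exp 1 + 1 :: real fps) 0 \<noteq> 0"
    by simp
  then show ?thesis
    unfolding euler_poly_generating_function
    by (simp add: fps_divide_unit mult.assoc inverse_mult_eq_1)
qed

definition hankel_det :: "nat \<Rightarrow> (nat \<Rightarrow> 'a :: comm_ring_1) \<Rightarrow> 'a" where
  "hankel_det n a = det (mat (n + 1) (n + 1) (\<lambda>(i, j). a (i + j)))"

definition b_seq :: "nat \<Rightarrow> real" where
  "b_seq k = (if k = 0 then 0 else euler_poly (2 * k - 1) 1 / fact (2 * k - 1))"

end

theory Submission imports Defs begin

text \<open>The Hankel matrices of \<open>b\<close> and of its shift \<open>b\<^sub>k\<^sub>+\<^sub>1 = E\<^sub>2\<^sub>k\<^sub>+\<^sub>1(1) / (2k+1)!\<close> share all columns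
  but one, so a single relation among the \<open>n + 2\<close> columns \<open>(b\<^sub>i\<^sub>+\<^sub>j)\<^sub>i\<^sub>\<le>\<^sub>n\<close>, \<open>j \<le> n + 1\<close>, determines the
  quotient of their determinants. The \<open>b\<^sub>k\<close> are the coefficients of \<open>tanh (t/2) = (e\<^sup>t - 1) / (e\<^sup>t + 1)\<close>.
  If \<open>p(-t) e\<^sup>t - p(t) = O(t\<^bsup>4n+3\<^esup>)\<close> and \<open>e\<close>, \<open>o\<close> are the even and the odd part of \<open>p\<close>, then
  \<open>e tanh (t/2) - o = O(t\<^bsup>4n+3\<^esup>)\<close>; if moreover \<open>deg e \<le> 2n + 2\<close> and \<open>deg o < 2n + 1\<close>, the coefficients
  of \<open>e\<close> give such a relation. A suitable \<open>p\<close> is \<open>t\<^sup>2 P\<^sub>2\<^sub>n - 2n (2n+1) P\<^sub>2\<^sub>n\<^sub>+\<^sub>1\<close>, where \<open>P\<^sub>N(t) / P\<^sub>N(-t)\<close>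
  is the diagonal Pade approximant of \<open>e\<^sup>t\<close>.\<close>

section \<open>Hankel determinants and column relations\<close>

text \<open>Cramer's rule: by the relation, column 0 of the unshifted matrix \<open>B\<close> is
  minus the combination \<open>A *\<^sub>v x\<close> of the columns of the shifted matrix
  \<open>A\<close>. Putting \<open>A *\<^sub>v x\<close> into the last column of \<open>A\<close>
  multiplies \<open>det A\<close> by \<open>u (Suc n)\<close>; moving that column to the front past
  n others gives (-1)^n, and the negation one more sign.\<close>

lemma hankel_det_shift:
  fixes a u :: "nat \<Rightarrow> 'a :: comm_ring_1"
  assumes rel: "\<And>i. i \<le> n \<Longrightarrow> (\<Sum>j\<le>Suc n. u j * a (i + j)) = 0"
    and u0: "u 0 = 1"
  shows "hankel_det n a = (- 1) ^ Suc n * u (Suc n) * hankel_det n (\<lambda>k. a (Suc k))"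
proof -
  define A where "A = mat (Suc n) (Suc n) (\<lambda>(i, j). a (Suc (i + j)))"
  define B where "B = mat (Suc n) (Suc n) (\<lambda>(i, j). a (i + j))"
  define x where "x = vec (Suc n) (\<lambda>j. u (Suc j))"
  define R where "R = replace_col A (A *\<^sub>v x) n"
  have A: "A \<in> carrier_mat (Suc n) (Suc n)" and B: "B \<in> carrier_mat (Suc n) (Suc n)"
    and R: "R \<in> carrier_mat (Suc n) (Suc n)"
    by (auto simp: A_def B_def R_def replace_col_def)
  have detR: "det R = u (Suc n) * det A"
    unfolding R_def using cramer_lemma_mat[OF A, of x n] by (simp add: x_def)
  have Ax: "(A *\<^sub>v x) $ i = - a i" if "i \<le> n" for i
  proof -
    have "(A *\<^sub>v x) $ i = (\<Sum>j<Suc n. u (Suc j) * a (i + Suc j))"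
      using that by (simp add: A_def x_def scalar_prod_def atLeast0LessThan mult.commute)
    also have "\<dots> = (\<Sum>j\<le>Suc n. u j * a (i + j)) - u 0 * a i"
      by (subst sum.atMost_Suc_shift) (simp add: lessThan_Suc_atMost)
    finally show ?thesis
      using rel[OF that] u0 by simp
  qed
  \<comment> \<open>Columns 1 to n of \<open>B\<close> are columns 0 to n - 1 of \<open>A\<close>,
    which the replacement in \<open>R\<close> leaves intact.\<close>
  have minor: "mat_delete R i n = mat_delete B i 0" if "i \<le> n" for i
    using that
    by (intro eq_matI) (auto simp: mat_delete_def R_def replace_col_def A_def B_def)
  have "det B = (\<Sum>i<Suc n. B $$ (i, 0) * cofactor B i 0)"
    by (rule laplace_expansion_column[OF B]) simp
  also have "\<dots> = (\<Sum>i<Suc n. (- 1) ^ Suc n * (R $$ (i, n) * cofactor R i n))"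
  proof (rule sum.cong[OF refl])
    fix i assume "i \<in> {..<Suc n}"
    then have i: "i \<le> n" by simp
    have Rin: "R $$ (i, n) = - a i"
      using i Ax[OF i] by (simp add: R_def replace_col_def A_def)
    have Bi0: "B $$ (i, 0) = a i"
      using i by (simp add: B_def)
    have sgn: "(- 1) ^ n * (- 1) ^ n = (1 :: 'a)"
      by (simp flip: power_add mult_2)
    have "(- 1) ^ Suc n * (R $$ (i, n) * cofactor R i n)
        = ((- 1) ^ n * (- 1) ^ n) * (a i * ((- 1) ^ i * det (mat_delete B i 0)))"
      unfolding cofactor_def Rin minor[OF i] by (simp add: power_add mult_ac)
    then show "B $$ (i, 0) * cofactor B i 0 = (- 1) ^ Suc n * (R $$ (i, n) * cofactor R i n)"
      unfolding cofactor_def Bi0 sgn by simp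
  qed
  also have "\<dots> = (- 1) ^ Suc n * (\<Sum>i<Suc n. R $$ (i, n) * cofactor R i n)"
    by (simp only: sum_distrib_left)
  also have "(\<Sum>i<Suc n. R $$ (i, n) * cofactor R i n) = det R"
    by (rule laplace_expansion_column[OF R, symmetric]) simp
  finally have "det B = (- 1) ^ Suc n * (u (Suc n) * det A)"
    unfolding detR .
  then show ?thesis
    by (simp add: hankel_det_def A_def B_def mult.assoc)
qed

section \<open>Pade approximants of the exponential series\<close>

no_notation vec_index (infixl "$" 100)
unbundle fps_syntax

text \<open>The numerator of the \<open>[N/N]\<close> Pade approximant of \<open>e\<^sup>t\<close>, normalised to be monic;
  the denominator is obtained by \<open>t \<mapsto> -t\<close>.\<close>

fun pade_exp :: "nat \<Rightarrow> real fps" where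
  "pade_exp 0 = 1"
| "pade_exp (Suc 0) = 2 + fps_X"
| "pade_exp (Suc (Suc N)) = of_nat (4 * N + 6) * pade_exp (Suc N) + fps_X ^ 2 * pade_exp N"

fun pade_exp_denom :: "nat \<Rightarrow> real fps" where
  "pade_exp_denom 0 = 1"
| "pade_exp_denom (Suc 0) = 2 - fps_X"
| "pade_exp_denom (Suc (Suc N)) =
     of_nat (4 * N + 6) * pade_exp_denom (Suc N) + fps_X ^ 2 * pade_exp_denom N"

lemma fps_of_nat_mult_nth: "(of_nat c * f) $ k = of_nat c * (f $ k)"
  for f :: "'a :: comm_ring_1 fps"
  by (simp flip: fps_of_nat)

lemma pade_exp_nth_Suc_Suc:
  "pade_exp (Suc (Suc N)) $ k =
     of_nat (4 * N + 6) * pade_exp (Suc N) $ k + (if k < 2 then 0 else pade_exp N $ (k - 2))"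
  by (simp add: fps_of_nat_mult_nth fps_X_power_mult_nth del: of_nat_add of_nat_mult)

lemma pade_exp_denom_nth: "pade_exp_denom N $ k = (- 1) ^ k * pade_exp N $ k"
proof (induction N arbitrary: k rule: pade_exp.induct)
  case 1
  then show ?case by simp
next
  case 2
  then show ?case by (cases "k = 0") (auto simp: fps_X_def fps_numeral_nth)
next
  case (3 N)
  have "(- 1) ^ (k - 2) = ((- 1) ^ k :: real)" if "\<not> k < 2"
    using that by (simp add: minus_one_power_iff)
  then show ?case
    using 3 unfolding pade_exp_nth_Suc_Suc
    by (simp add: fps_of_nat_mult_nth fps_X_power_mult_nth distrib_left mult.left_commute
        del: of_nat_add of_nat_mult)
qed

lemma pade_exp_nth_eq_0: "k > N \<Longrightarrow> pade_exp N $ k = 0"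
proof (induction N arbitrary: k rule: pade_exp.induct)
  case 2
  then show ?case by (auto simp: fps_X_def fps_numeral_nth)
next
  case (3 N)
  then show ?case unfolding pade_exp_nth_Suc_Suc by simp
qed simp

lemma pade_exp_nth_degree: "pade_exp N $ N = 1"
proof (induction N rule: pade_exp.induct)
  case 2
  then show ?case by (auto simp: fps_X_def fps_numeral_nth)
next
  case (3 N)
  then show ?case unfolding pade_exp_nth_Suc_Suc by (simp add: pade_exp_nth_eq_0)
qed simp

text \<open>For \<open>Suc N\<close> = 2n this is the source of the factor 2n (2n+1): the monic
  \<open>pade_exp (2 * n + 1)\<close> must be scaled by it to cancel the t^(2n+1) term of t^2
  \<open>pade_exp (2 * n)\<close>.\<close>

lemma pade_exp_nth_pred_degree: "pade_exp (Suc N) $ N = of_nat (Suc N * (N + 2))"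
proof (induction N rule: pade_exp.induct)
  case 1
  then show ?case by (simp add: fps_numeral_nth)
next
  case 2
  show ?case using pade_exp_nth_degree[of 1] pade_exp_nth_Suc_Suc[of 0 1]
    by (simp del: pade_exp.simps)
next
  case (3 N)
  show ?case
    using 3(2) pade_exp_nth_degree[of "Suc (Suc N)"]
      pade_exp_nth_Suc_Suc[of "Suc N" "Suc (Suc N)"]
    by (simp add: algebra_simps del: pade_exp.simps)
qed

text \<open>At t = 0 the recurrence loses its t^2 term and becomes first-order. This value produces
  the factorial quotient of the theorem.\<close>

lemma pade_exp_nth_0: "pade_exp N $ 0 = fact (2 * N) / fact N"
proof (induction N rule: pade_exp.induct)
  case 2
  then show ?case by (simp add: fps_numeral_nth)
next
  case (3 N)
  have "fact (2 * Suc (Suc N)) / fact (Suc (Suc N)) =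
      (of_nat (4 * N + 6) * (fact (2 * Suc N) / fact (Suc N)) :: real)"
    by (simp add: divide_simps) (simp add: algebra_simps)
  then show ?case unfolding pade_exp_nth_Suc_Suc using 3 by simp
qed simp

text \<open>Up to the factor (-1)^N N! / (2N+1)!, this is Kummer's series 1F1(N+1; 2N+2; t).\<close>

definition pade_exp_remainder :: "nat \<Rightarrow> real fps" where
  "pade_exp_remainder N = Abs_fps (\<lambda>k. (- 1) ^ N * fact (N + k) / (fact k * fact (2 * N + 1 + k)))"

text \<open>This is the recurrence of \<open>pade_exp\<close> for the full errors t^(2N+1)
  \<open>pade_exp_remainder N\<close>, divided by t^(2N+3).\<close>

lemma pade_exp_remainder_Suc_Suc:
  "fps_X ^ 2 * pade_exp_remainder (Suc (Suc N)) =
     of_nat (4 * N + 6) * pade_exp_remainder (Suc N) + pade_exp_remainder N"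
proof (rule fps_ext)
  fix k
  \<comment> \<open>The factor t^2 on the left means that the first two coefficients on the right
    have to cancel.\<close>
  consider "k = 0" | "k = 1" | j where "k = Suc (Suc j)"
    by (metis One_nat_def not0_implies_Suc)
  then show "(fps_X ^ 2 * pade_exp_remainder (Suc (Suc N))) $ k =
     (of_nat (4 * N + 6) * pade_exp_remainder (Suc N) + pade_exp_remainder N) $ k"
  proof cases
    case 1
    then show ?thesis
      by (simp add: fps_of_nat_mult_nth fps_X_power_mult_nth pade_exp_remainder_def divide_simps
          del: of_nat_add of_nat_mult) (simp add: algebra_simps)
  next
    case 2
    then show ?thesis
      by (simp add: fps_of_nat_mult_nth fps_X_power_mult_nth pade_exp_remainder_def divide_simps
          del: of_nat_add of_nat_mult) (simp add: algebra_simps)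
  next
    case (3 j)
    then show ?thesis
      by (simp add: fps_of_nat_mult_nth fps_X_power_mult_nth pade_exp_remainder_def divide_simps
          del: of_nat_add of_nat_mult) (simp add: algebra_simps)
  qed
qed

text \<open>Both sides satisfy the same three-term linear recurrence, so the cases N = 0 and N = 1
  suffice.\<close>

lemma pade_exp_remainder:
  "pade_exp_denom N * fps_exp 1 - pade_exp N = fps_X ^ (2 * N + 1) * pade_exp_remainder N"
proof (induction N rule: pade_exp.induct)
  case 1
  show ?case
    by (rule fps_ext) (auto simp: pade_exp_remainder_def fact_reduce)
next
  case 2
  show ?case
  proof (rule fps_ext)
    fix k :: nat
    have "k = 0 \<or> k = 1 \<or> k = 2 \<or> (\<exists>j. k = j + 3)"
      by presburger
    then consider "k < 3" | j where "k = j + 3"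
      by force
    then show "(pade_exp_denom (Suc 0) * fps_exp 1 - pade_exp (Suc 0)) $ k =
        (fps_X ^ (2 * Suc 0 + 1) * pade_exp_remainder (Suc 0)) $ k"
    proof cases
      case 1
      then have "k = 0 \<or> k = 1 \<or> k = 2" by auto
      then show ?thesis
        by (auto simp: left_diff_distrib fps_numeral_nth fps_X_power_mult_nth numeral_fps_const
            fact_numeral)
    next
      case (2 j)
      have "2 / fact (j + 3) - 1 / fact (j + 2) = - (fact (Suc j) / (fact j * fact (j + 3)) :: real)"
        by (simp add: eval_nat_numeral divide_simps)
      with 2 show ?thesis
        by (simp add: left_diff_distrib fps_numeral_nth fps_X_power_mult_nth numeral_fps_const
            pade_exp_remainder_def add.commute[of 3 j] del: fact_Suc)
    qed
  qed
next
  case (3 N)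
  have "pade_exp_denom (Suc (Suc N)) * fps_exp 1 - pade_exp (Suc (Suc N)) =
      of_nat (4 * N + 6) * (pade_exp_denom (Suc N) * fps_exp 1 - pade_exp (Suc N))
      + fps_X ^ 2 * (pade_exp_denom N * fps_exp 1 - pade_exp N)"
    by (simp add: algebra_simps)
  also have "\<dots> = fps_X ^ (2 * N + 3) *
      (of_nat (4 * N + 6) * pade_exp_remainder (Suc N) + pade_exp_remainder N)"
    unfolding 3 by (simp add: algebra_simps power_add power2_eq_square power3_eq_cube)
  also have "\<dots> = fps_X ^ (2 * Suc (Suc N) + 1) * pade_exp_remainder (Suc (Suc N))"
    unfolding pade_exp_remainder_Suc_Suc[symmetric]
    by (simp add: algebra_simps power_add power2_eq_square power3_eq_cube)
  finally show ?case .
qed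

section \<open>The column relation for \<open>b_seq\<close>\<close>

lemma fps_even_mult_nth_odd:
  fixes f g :: "'a :: comm_ring_1 fps"
  assumes even: "\<And>k. odd k \<Longrightarrow> f $ k = 0" and deg: "\<And>k. k > 2 * m \<Longrightarrow> f $ k = 0"
  shows "(f * g) $ (2 * l + 1) = (\<Sum>j\<le>min m l. f $ (2 * j) * g $ (2 * (l - j) + 1))"
proof -
  have "(f * g) $ (2 * l + 1) = (\<Sum>k=0..2 * l + 1. f $ k * g $ (2 * l + 1 - k))"
    by (rule fps_mult_nth)
  also have "\<dots> = (\<Sum>k\<in>(\<lambda>j. 2 * j) ` {..min m l}. f $ k * g $ (2 * l + 1 - k))"
  proof (rule sum.mono_neutral_right)
    show "\<forall>k\<in>{0..2 * l + 1} - (\<lambda>j. 2 * j) ` {..min m l}. f $ k * g $ (2 * l + 1 - k) = 0"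
    proof
      fix k assume k: "k \<in> {0..2 * l + 1} - (\<lambda>j. 2 * j) ` {..min m l}"
      have "odd k \<or> k > 2 * m"
      proof (rule ccontr)
        assume "\<not> (odd k \<or> k > 2 * m)"
        then obtain j where "k = 2 * j" "j \<le> m" by (auto elim: evenE)
        with k show False by auto
      qed
      then show "f $ k * g $ (2 * l + 1 - k) = 0"
        using even deg by auto
    qed
  qed auto
  also have "\<dots> = (\<Sum>j\<le>min m l. f $ (2 * j) * g $ (2 * l + 1 - 2 * j))"
    by (subst sum.reindex) (auto simp: inj_on_def)
  also have "\<dots> = (\<Sum>j\<le>min m l. f $ (2 * j) * g $ (2 * (l - j) + 1))"
    by (intro sum.cong refl arg_cong2[where f = "(*)"] arg_cong[where f = "($) g"]) auto
  finally show ?thesis .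
qed

text \<open>The weights are the even coefficients of p in reverse order: the coefficient of t^(2n+2)
  goes to column 0 and the constant term to column n + 1. The sum is then an odd coefficient of
  \<open>e * T\<close>.\<close>

lemma b_seq_relation:
  fixes n :: nat
  defines "P \<equiv> \<lambda>k. (if k < 2 then 0 else pade_exp (2 * n) $ (k - 2))
                     - of_nat (2 * n * (2 * n + 1)) * pade_exp (2 * n + 1) $ k"
  assumes i: "i \<le> n"
  shows "(\<Sum>j\<le>Suc n. P (2 * (Suc n - j)) * b_seq (i + j)) = 0"
proof -
  define c :: nat where "c = 2 * n * (2 * n + 1)"
  define p where "p = fps_X ^ 2 * pade_exp (2 * n) - of_nat c * pade_exp (2 * n + 1)"
  define q where "q = fps_X ^ 2 * pade_exp_denom (2 * n) - of_nat c * pade_exp_denom (2 * n + 1)"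
  define e where "e = Abs_fps (\<lambda>k. if even k then P k else 0)"
  define d where "d = Abs_fps (\<lambda>k. if odd k then P k else 0)"
  \<comment> \<open>This is tanh(t/2), as 2 e^t / (e^t + 1) - 1 = (e^t - 1) / (e^t + 1).\<close>
  define T :: "real fps" where "T = Abs_fps (\<lambda>k. euler_poly k 1 / fact k) - 1"
  define R where
    "R = pade_exp_remainder (2 * n) - of_nat c * pade_exp_remainder (2 * n + 1)"
  have p_nth: "p $ k = P k" for k
    by (simp add: p_def P_def c_def fps_of_nat_mult_nth fps_X_power_mult_nth
        del: of_nat_add of_nat_mult)
  have q_nth: "q $ k = (- 1) ^ k * P k" for k
  proof -
    have "(- 1) ^ (k - 2) = ((- 1) ^ k :: real)" if "\<not> k < 2"
      using that by (simp add: minus_one_power_iff)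
    then show ?thesis
      by (simp add: q_def P_def c_def fps_of_nat_mult_nth fps_X_power_mult_nth pade_exp_denom_nth
          algebra_simps del: of_nat_add of_nat_mult)
  qed
  have p_eq: "p = e + d" and q_eq: "q = e - d"
    by (auto simp: fps_eq_iff p_nth q_nth e_def d_def)
  have P_high: "P k = 0" if "k > 2 * Suc n" for k
    using that by (auto simp: P_def pade_exp_nth_eq_0)
  \<comment> \<open>The choice of \<open>c\<close> takes effect here: the odd part \<open>d\<close>
    loses its top coefficient.\<close>
  have "P (2 * n + 1) = 0"
  proof (cases n)
    case 0
    then show ?thesis by (simp add: P_def)
  next
    case (Suc m)
    then show ?thesis
      using pade_exp_nth_pred_degree[of "2 * n - 1"] pade_exp_nth_degree[of "2 * n + 1"]
      by (simp add: P_def del: pade_exp.simps)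
  qed
  then have d_nth: "d $ k = 0" if "k \<ge> 2 * n + 1" for k
    using P_high[of k] that by (cases "k = 2 * n + 1"; cases "k = 2 * n + 2") (auto simp: d_def)
  have "q * fps_exp 1 - p =
      fps_X ^ 2 * (pade_exp_denom (2 * n) * fps_exp 1 - pade_exp (2 * n))
      - of_nat c * (pade_exp_denom (2 * n + 1) * fps_exp 1 - pade_exp (2 * n + 1))"
    unfolding p_def q_def by (simp add: algebra_simps del: pade_exp.simps pade_exp_denom.simps)
  \<comment> \<open>Both errors start at the same order: 2 + (2 (2n) + 1) = 2 (2n+1) + 1 = 4n +
    3.\<close>
  also have "\<dots> = fps_X ^ (4 * n + 3) * R"
    unfolding pade_exp_remainder R_def
    by (simp add: algebra_simps power_add power2_eq_square power3_eq_cube)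
  finally have R: "q * fps_exp 1 - p = fps_X ^ (4 * n + 3) * R" .
  have unit: "(fps_exp 1 + 1 :: real fps) $ 0 \<noteq> 0" by simp
  have T: "T * (fps_exp 1 + 1) = fps_exp 1 - 1"
    using euler_poly_generating_function_mult[of 1]
    by (simp add: T_def left_diff_distrib numeral_fps_const[symmetric] algebra_simps)
  \<comment> \<open>The right side is e (e^t - 1) - d (e^t + 1) = (e - d) e^t - (e + d), that is, q
    e^t - p.\<close>
  have "(e * T - d) * (fps_exp 1 + 1) = e * (T * (fps_exp 1 + 1)) - d * (fps_exp 1 + 1)"
    by (simp add: algebra_simps)
  also have "\<dots> = fps_X ^ (4 * n + 3) * R"
    unfolding T R[symmetric] p_eq q_eq by (simp add: algebra_simps)
  finally have "(e * T - d) * (fps_exp 1 + 1) * inverse (fps_exp 1 + 1) =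
      fps_X ^ (4 * n + 3) * R * inverse (fps_exp 1 + 1)"
    by (rule arg_cong)
  then have "e * T - d = fps_X ^ (4 * n + 3) * (R * inverse (fps_exp 1 + 1))"
    by (simp only: mult.assoc inverse_mult_eq_1'[OF unit] mult_1_right)
  then have eT: "e * T = d + fps_X ^ (4 * n + 3) * (R * inverse (fps_exp 1 + 1))"
    by (simp only: diff_eq_eq add.commute)
  have b: "b_seq (Suc k) = T $ (2 * k + 1)" for k
    by (simp add: b_seq_def T_def)
  have "(\<Sum>j\<le>Suc n. P (2 * (Suc n - j)) * b_seq (i + j)) =
      (\<Sum>j\<le>Suc n. P (2 * j) * b_seq (i + (Suc n - j)))"
    by (rule sum.reindex_bij_witness[of _ "\<lambda>j. Suc n - j" "\<lambda>j. Suc n - j"]) auto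
  \<comment> \<open>Only for i = 0 is a term dropped, j = n + 1, and it contains
    \<open>b_seq 0\<close> = 0.\<close>
  also have "\<dots> = (\<Sum>j\<le>min (Suc n) (n + i). P (2 * j) * b_seq (i + (Suc n - j)))"
    by (rule sum.mono_neutral_right) (auto simp: b_seq_def)
  also have "\<dots> = (\<Sum>j\<le>min (Suc n) (n + i). e $ (2 * j) * T $ (2 * (n + i - j) + 1))"
  proof (rule sum.cong[OF refl])
    fix j assume "j \<in> {..min (Suc n) (n + i)}"
    then have "i + (Suc n - j) = Suc (n + i - j)" by auto
    then show "P (2 * j) * b_seq (i + (Suc n - j)) = e $ (2 * j) * T $ (2 * (n + i - j) + 1)"
      by (simp only: b) (simp add: e_def)
  qed
  also have "\<dots> = (e * T) $ (2 * (n + i) + 1)"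
    by (rule fps_even_mult_nth_odd[symmetric]) (auto simp: e_def P_high)
  \<comment> \<open>The index 2(n+i) + 1 lies between 2n + 1, where \<open>d\<close> has already
    ended, and 4n + 1, below the order 4n + 3 of the error.\<close>
  also have "\<dots> = 0"
    unfolding eT using i d_nth[of "2 * (n + i) + 1"] by (simp add: fps_X_power_mult_nth)
  finally show ?thesis .
qed

theorem proposition6p3:
  fixes n :: nat
  assumes "n \<ge> 1"
  shows "hankel_det n b_seq =
    (- 1) ^ n * (fact (4 * n + 2) / fact (2 * n - 1)) *
    hankel_det n (\<lambda>k. euler_poly (2 * k + 1) 1 / fact (2 * k + 1))"
proof -
  define P :: "nat \<Rightarrow> real" where
    "P = (\<lambda>k. (if k < 2 then 0 else pade_exp (2 * n) $ (k - 2))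
              - of_nat (2 * n * (2 * n + 1)) * pade_exp (2 * n + 1) $ k)"
  have lead: "P (2 * (Suc n - 0)) = 1"
    by (simp add: P_def pade_exp_nth_degree pade_exp_nth_eq_0 del: pade_exp.simps)
  \<comment> \<open>The factor 2n (2n+1) of \<open>P\<close> thus turns (4n+2)! / (2n+1)! into
    (4n+2)! / (2n-1)!; n \<ge> 1 keeps 2n - 1 from being truncated.\<close>
  have "fact (2 * n + 1) = (of_nat (2 * n * (2 * n + 1)) * fact (2 * n - 1) :: real)"
    using assms by (cases n) (simp_all add: algebra_simps)
  then have const: "P (2 * (Suc n - Suc n)) = - (fact (4 * n + 2) / fact (2 * n - 1))"
    using pade_exp_nth_0[of "2 * n + 1"] assms
    by (simp add: P_def del: pade_exp.simps of_nat_mult of_nat_add fact_Suc)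
  have "hankel_det n b_seq =
      (- 1) ^ Suc n * P (2 * (Suc n - Suc n)) * hankel_det n (\<lambda>k. b_seq (Suc k))"
    using b_seq_relation[of _ n] lead unfolding P_def by (rule hankel_det_shift)
  also have "(\<lambda>k. b_seq (Suc k)) = (\<lambda>k. euler_poly (2 * k + 1) 1 / fact (2 * k + 1))"
    by (simp add: b_seq_def fun_eq_iff)
  finally show ?thesis
    unfolding const by simp
qed

end
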